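(* Let $\lambda>0$, $\mu>0$, and let $g\colon\mathbb{R}^n\to\mathbb{R}\cup\{\infty\}$ be closed, proper, and $\mu$-strongly convex, with minimizer $x_\star$. Let $q=\frac{\lambda\mu}{\lambda\mu+1}$, let $A_0=0$ and, for $k=0,1,\dots$, $$A_{k+1}=\frac{(1+q)A_k+2\left(1+\sqrt{(1+A_k)(1+qA_k)}\right)}{(1-q)^2},\qquad \gamma_k=\frac{A_k}{(1-q)A_{k+1}},\qquad \delta_k=\frac{(1-q)^2A_{k+1}-(1+q)A_k}{2(1+q+qA_k)}.$$ Let $x_0\in\mathbb{R}^n$, set $x_{-1}^\circ=x_0=z_0$, and let the sequences $\{x_k\},\{z_k\}$ be generated by Proximal-ITEM: $$x_k=\gamma_kx_{k-1}^\circ+(1-\gamma_k)z_k,\qquad z_{k+1}=q\delta_kx_k^{\circ\circ}+(1-q\delta_k)z_k,\qquad k=0,1,\dots.$$ Then, for all $k=0,1,\dots$, $$\|z_k-x_\star\|^2\le\frac{(1-\sqrt q)^{2k}}{(1-\sqrt q)^{2k}+q}\|z_0-x_\star\|^2.$$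
   Context: $\|\cdot\|$ is the Euclidean norm. $g$ is $\mu$-strongly convex if $g(x)-(\mu/2)\|x\|^2$ is convex. $x^\circ=\operatorname{Prox}_{\lambda g}(x)=\operatorname*{arg\,min}_{y\in\mathbb{R}^n}\{g(y)+\frac1{2\lambda}\|y-x\|^2\}$, $\tilde\nabla_{1/\lambda}g(x):=-\frac1\lambda(x^\circ-x)$, and $x_k^{\circ\circ}=x_k-\left(\lambda+\frac1\mu\right)\tilde\nabla_{1/\lambda}g(x_k)$.
   Formalization: The bound is stated for all k ≥ 1 instead of k ≥ 0; at k = 0 it would read ‖z_0−x⋆‖² ≤ ‖z_0−x⋆‖²/(1+q) with q > 0, which is false whenever z_0 ≠ x⋆ (e.g. g = ‖x‖²/2, μ = λ = 1, x_0 ≠ 0). *)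

theory Defs
  imports "HOL-Analysis.Analysis"
begin

text \<open>
  A function with values in the reals extended by \<open>\<infinity>\<close> is an \<^typ>\<open>ereal\<close>-valued function that
  never takes the value \<open>-\<infinity>\<close>; this restriction is part of \<open>proper_fun\<close>. The constants of the
  same flavour in the library (\<^const>\<open>convex_on\<close>, \<^const>\<open>epigraph\<close>) only cover real-valued functions.
\<close>

definition proper_fun :: "('a \<Rightarrow> ereal) \<Rightarrow> bool" where
  "proper_fun g \<longleftrightarrow> (\<forall>x. g x \<noteq> -\<infinity>) \<and> (\<exists>x. g x \<noteq> \<infinity>)"

definition closed_fun :: "('a::topological_space \<Rightarrow> ereal) \<Rightarrow> bool" where
  "closed_fun g \<longleftrightarrow> closed {(x, t :: real). g x \<le> ereal t}"

text \<open>In \<^typ>\<open>ereal\<close> we have \<open>0 * \<infinity> = 0\<close>, so the end points \<open>u = 0\<close> and \<open>v = 0\<close> are harmless.\<close>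

definition convex_fun :: "('a::real_vector \<Rightarrow> ereal) \<Rightarrow> bool" where
  "convex_fun g \<longleftrightarrow> (\<forall>x y. \<forall>u\<ge>0. \<forall>v\<ge>0. u + v = 1 \<longrightarrow>
     g (u *\<^sub>R x + v *\<^sub>R y) \<le> ereal u * g x + ereal v * g y)"

definition strongly_convex_fun :: "real \<Rightarrow> ('a::real_normed_vector \<Rightarrow> ereal) \<Rightarrow> bool" where
  "strongly_convex_fun \<mu> g \<longleftrightarrow> convex_fun (\<lambda>x. g x - ereal (\<mu> / 2 * (norm x)\<^sup>2))"

definition prox :: "real \<Rightarrow> ('a::real_normed_vector \<Rightarrow> ereal) \<Rightarrow> 'a \<Rightarrow> 'a" where
  "prox lam g x = arg_min (\<lambda>y. g y + ereal (1 / (2 * lam) * (norm (y - x))\<^sup>2)) (\<lambda>_. True)"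

text \<open>
  The vector written as the gradient of \<open>g\<close> with a tilde and index \<open>1 / lam\<close>; the first argument
  here is \<open>lam\<close> itself.
\<close>

definition prox_grad :: "real \<Rightarrow> ('a::real_normed_vector \<Rightarrow> ereal) \<Rightarrow> 'a \<Rightarrow> 'a" where
  "prox_grad lam g x = - (1 / lam) *\<^sub>R (prox lam g x - x)"

definition prox_step :: "real \<Rightarrow> real \<Rightarrow> ('a::real_normed_vector \<Rightarrow> ereal) \<Rightarrow> 'a \<Rightarrow> 'a" where
  "prox_step lam \<mu> g x = x - (lam + 1 / \<mu>) *\<^sub>R prox_grad lam g x"

end

theory Submission
  imports Defs
begin

text \<open>
  Write \<open>P k = prox lam g (x k)\<close>. The vector \<open>(x k - P k) / lam\<close> is a subgradient of \<open>g\<close> at \<open>P k\<close>, so strong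
  convexity bounds \<open>g\<close> below at the previous proximal point and at the minimizer \<open>x_star\<close>. Adding these two
  inequalities with weights \<open>A k\<close> and \<open>A (Suc k) - A k\<close> shows that the potential
  \<open>q / \<mu> * A k * (g (P (k - 1)) - g x_star - \<mu> / 2 * |P (k - 1) - x_star|\<^sup>2) + (1 + q * A k) * |z k - x_star|\<^sup>2\<close>
  does not increase. Its first term is nonnegative because \<open>g\<close> grows quadratically at its minimizer, and
  the recursion gives \<open>A k \<ge> (1 - sqrt q) ^ (-2 * k)\<close> for \<open>k \<ge> 1\<close>.
\<close>

section \<open>First-order inequalities from strong convexity\<close>

text \<open>Divide by \<open>t\<close> and let \<open>t\<close> tend to 0 from the right. This
  extracts a first-order condition from minimality along a segment.\<close>

lemma linear_coeff_nonneg: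
  fixes a b :: real
  assumes "\<And>t. 0 < t \<Longrightarrow> t \<le> 1 \<Longrightarrow> 0 \<le> t * a + t\<^sup>2 * b"
  shows "0 \<le> a"
proof (rule tendsto_lowerbound)
  show "((\<lambda>t. a + t * b) \<longlongrightarrow> a) (at_right 0)"
    by (auto intro!: tendsto_eq_intros)
  have "0 \<le> a + t * b" if "t \<in> {0<..<1}" for t
  proof -
    have "0 \<le> t * (a + t * b)"
      using assms[of t] that by (simp add: power2_eq_square algebra_simps)
    with that show ?thesis by (simp add: zero_le_mult_iff)
  qed
  then show "\<forall>\<^sub>F t in at_right 0. 0 \<le> a + t * b"
    by (rule eventually_at_rightI[of 0 1]) auto
qed simp

text \<open>The squared norm satisfies an exact identity along segments, so adding the subtracted
  quadratic back yields precisely the term with \<open>t * (1 - t)\<close>.\<close>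

lemma strongly_convex_funD:
  fixes g :: "'a::real_inner \<Rightarrow> ereal"
  assumes "strongly_convex_fun \<mu> g" "g y = ereal a" "g p = ereal b" "0 \<le> t" "t \<le> 1"
  shows "g (p + t *\<^sub>R (y - p))
    \<le> ereal ((1 - t) * b + t * a - \<mu> / 2 * (t * (1 - t)) * (norm (y - p))\<^sup>2)"
proof -
  define w where "w = p + t *\<^sub>R (y - p)"
  have w: "w = (1 - t) *\<^sub>R p + t *\<^sub>R y"
    by (simp add: w_def algebra_simps)
  have "g w - ereal (\<mu> / 2 * (norm w)\<^sup>2)
    \<le> ereal (1 - t) * (g p - ereal (\<mu> / 2 * (norm p)\<^sup>2)) + ereal t * (g y - ereal (\<mu> / 2 * (norm y)\<^sup>2))"
    using assms(1,4,5) unfolding w strongly_convex_fun_def convex_fun_def by simp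
  then have "g w \<le> ereal ((1 - t) * (b - \<mu> / 2 * (norm p)\<^sup>2) + t * (a - \<mu> / 2 * (norm y)\<^sup>2)
      + \<mu> / 2 * (norm w)\<^sup>2)"
    using assms(2,3) by (cases "g w") auto
  moreover have "(norm w)\<^sup>2 = (1 - t) * (norm p)\<^sup>2 + t * (norm y)\<^sup>2 - t * (1 - t) * (norm (y - p))\<^sup>2"
    unfolding w power2_norm_eq_inner
    by (simp add: inner_commute power2_eq_square algebra_simps)
  then have "(1 - t) * (b - \<mu> / 2 * (norm p)\<^sup>2) + t * (a - \<mu> / 2 * (norm y)\<^sup>2) + \<mu> / 2 * (norm w)\<^sup>2
      = (1 - t) * b + t * a - \<mu> / 2 * (t * (1 - t)) * (norm (y - p))\<^sup>2"
    by algebra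
  ultimately show ?thesis
    unfolding w_def[symmetric] by simp
qed

text \<open>The proximal case is \<open>c = 1 / lam\<close>; \<open>c = 0\<close> gives quadratic growth at a minimizer.\<close>

lemma strongly_convex_prox_ineq:
  fixes g :: "'a::real_inner \<Rightarrow> ereal"
  assumes sc: "strongly_convex_fun \<mu> g" and a: "g y = ereal a" and b: "g p = ereal b"
    and min: "\<And>y. g p + ereal (c / 2 * (norm (p - x))\<^sup>2) \<le> g y + ereal (c / 2 * (norm (y - x))\<^sup>2)"
  shows "b + c * inner (x - p) (y - p) + \<mu> / 2 * (norm (y - p))\<^sup>2 \<le> a"
proof -
  \<comment> \<open>\<open>p\<close> is compared with \<open>p + t *\<^sub>R (y - p)\<close>: the
    coefficient of \<open>t\<close> is the claim, and the rest is of order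
    \<open>t\<^sup>2\<close>.\<close>
  have "0 \<le> t * (a - b - c * inner (x - p) (y - p) - \<mu> / 2 * (norm (y - p))\<^sup>2)
      + t\<^sup>2 * ((\<mu> + c) / 2 * (norm (y - p))\<^sup>2)" if t: "0 < t" "t \<le> 1" for t
  proof -
    let ?w = "p + t *\<^sub>R (y - p)"
    have "ereal (b + c / 2 * (norm (p - x))\<^sup>2) \<le> g ?w + ereal (c / 2 * (norm (?w - x))\<^sup>2)"
      using min[of ?w] b by simp
    also have "\<dots> \<le> ereal ((1 - t) * b + t * a - \<mu> / 2 * (t * (1 - t)) * (norm (y - p))\<^sup>2)
        + ereal (c / 2 * (norm (?w - x))\<^sup>2)"
      using strongly_convex_funD[OF sc a b, of t] t by (intro add_right_mono) auto
    finally have "b + c / 2 * (norm (p - x))\<^sup>2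
      \<le> (1 - t) * b + t * a - \<mu> / 2 * (t * (1 - t)) * (norm (y - p))\<^sup>2 + c / 2 * (norm (?w - x))\<^sup>2"
      by simp
    moreover have "(norm (?w - x))\<^sup>2
        = (norm (p - x))\<^sup>2 - 2 * t * inner (x - p) (y - p) + t\<^sup>2 * (norm (y - p))\<^sup>2"
      unfolding power2_norm_eq_inner
      by (simp add: inner_commute power2_eq_square algebra_simps)
    ultimately have "0 \<le> (1 - t) * b + t * a - \<mu> / 2 * (t * (1 - t)) * (norm (y - p))\<^sup>2
        + c / 2 * ((norm (p - x))\<^sup>2 - 2 * t * inner (x - p) (y - p) + t\<^sup>2 * (norm (y - p))\<^sup>2)
        - (b + c / 2 * (norm (p - x))\<^sup>2)"
      by simp
    also have "\<dots> = t * (a - b - c * inner (x - p) (y - p) - \<mu> / 2 * (norm (y - p))\<^sup>2)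
        + t\<^sup>2 * ((\<mu> + c) / 2 * (norm (y - p))\<^sup>2)"
      by (simp add: field_simps power2_eq_square)
    finally show ?thesis .
  qed
  from linear_coeff_nonneg[OF this] show ?thesis by simp
qed

section \<open>Existence of proximal points\<close>

text \<open>Direct method: the quadratic term bounds a minimizing sequence, a subsequence converges,
  and the closed epigraph controls \<open>g\<close> at the limit.\<close>

lemma closed_fun_attains_prox:
  fixes g :: "'a::euclidean_space \<Rightarrow> ereal"
  assumes cl: "closed_fun g" and c: "c > 0" and lb: "\<And>y. ereal l \<le> g y" and fin: "g y0 = ereal r"
  shows "\<exists>p. \<forall>y. g p + ereal (c * (norm (p - x))\<^sup>2) \<le> g y + ereal (c * (norm (y - x))\<^sup>2)"
proof -
  define h where "h y = g y + ereal (c * (norm (y - x))\<^sup>2)" for y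
  define M where "M = (INF y. h y)"
  have lbh: "ereal l + ereal (c * (norm (y - x))\<^sup>2) \<le> h y" for y
    unfolding h_def using lb by (rule add_right_mono)
  have "ereal l \<le> M"
    unfolding M_def
  proof (rule INF_greatest)
    fix y
    have "ereal l \<le> ereal l + ereal (c * (norm (y - x))\<^sup>2)" using c by simp
    with lbh show "ereal l \<le> h y" by (rule order_trans[rotated])
  qed
  moreover have "M \<le> ereal (r + c * (norm (y0 - x))\<^sup>2)"
    unfolding M_def by (rule INF_lower2[of y0]) (auto simp: h_def fin)
  ultimately obtain m where m: "M = ereal m" by (cases M) auto
  have "\<exists>y. h y < ereal (m + inverse (real (Suc n)))" for n
  proof -
    have "M < ereal (m + inverse (real (Suc n)))" by (simp add: m)
    then show ?thesis unfolding M_def INF_less_iff by blast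
  qed
  then obtain Y where Y: "\<And>n. h (Y n) < ereal (m + inverse (real (Suc n)))" by metis
  have "norm (Y n) \<le> norm x + sqrt ((m + 1 - l) / c)" for n
  proof -
    have "inverse (real (Suc n)) \<le> 1" by (simp add: field_simps)
    have "ereal (l + c * (norm (Y n - x))\<^sup>2) < ereal (m + inverse (real (Suc n)))"
      using order.strict_trans1[OF lbh Y] by simp
    then have "c * (norm (Y n - x))\<^sup>2 \<le> m + 1 - l"
      using \<open>inverse (real (Suc n)) \<le> 1\<close> by simp
    then have "norm (Y n - x) \<le> sqrt ((m + 1 - l) / c)"
      using c by (intro real_le_rsqrt) (simp add: field_simps)
    then show ?thesis using norm_triangle_sub[of "Y n" x] by simp
  qed
  then have "bounded (range Y)" by (auto simp: bounded_iff)
  then obtain p s where s: "strict_mono s" and lim: "(Y \<circ> s) \<longlonglongrightarrow> p"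
    using bounded_imp_convergent_subsequence by blast
  \<comment> \<open>\<open>T n\<close> bounds \<open>g (Y (s n))\<close> once the quadratic term is
    moved across, so the pairs \<open>(Y (s n), T n)\<close> lie in the epigraph, and so does their
    limit.\<close>
  define T where "T n = m + inverse (real (Suc (s n))) - c * (norm (Y (s n) - x))\<^sup>2" for n
  have "(\<lambda>n. inverse (real (Suc (s n)))) \<longlonglongrightarrow> 0"
    using LIMSEQ_subseq_LIMSEQ[OF LIMSEQ_inverse_real_of_nat s] by (simp add: o_def)
  then have limT: "T \<longlonglongrightarrow> m + 0 - c * (norm (p - x))\<^sup>2"
    unfolding T_def using lim[unfolded o_def] by (intro tendsto_intros)
  have "g (Y (s n)) \<le> ereal (T n)" for n
    using Y[of "s n"] unfolding h_def T_def by (cases "g (Y (s n))") auto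
  then have "(p, m + 0 - c * (norm (p - x))\<^sup>2) \<in> {(x, t :: real). g x \<le> ereal t}"
    using cl[unfolded closed_fun_def] tendsto_Pair[OF lim limT]
    by (elim closed_sequentially[rotated 2]) (auto simp: o_def)
  then have "h p \<le> M"
    unfolding h_def m by (cases "g p") auto
  moreover have "M \<le> h y" for y unfolding M_def by (rule INF_lower) simp
  ultimately show ?thesis unfolding h_def by (meson order_trans)
qed

text \<open>\<open>prox\<close> is defined by choice, so it is a minimizer only once some minimizer
  is known to exist.\<close>

lemma prox_minimizes:
  fixes g :: "'a::euclidean_space \<Rightarrow> ereal"
  assumes "closed_fun g" "lam > 0" "\<And>y. ereal l \<le> g y" "g y0 = ereal r"
  shows "g (prox lam g x) + ereal (1 / (2 * lam) * (norm (prox lam g x - x))\<^sup>2)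
    \<le> g y + ereal (1 / (2 * lam) * (norm (y - x))\<^sup>2)"
proof -
  let ?h = "\<lambda>y. g y + ereal (1 / (2 * lam) * (norm (y - x))\<^sup>2)"
  obtain p where p: "\<forall>y. ?h p \<le> ?h y"
    using closed_fun_attains_prox[OF assms(1) _ assms(3,4), of "1 / (2 * lam)" x] assms(2) by auto
  then have "is_arg_min ?h (\<lambda>_. True) p" by (auto simp: is_arg_min_def not_less)
  then have "is_arg_min ?h (\<lambda>_. True) (prox lam g x)"
    unfolding prox_def arg_min_def by (rule someI)
  then show ?thesis by (auto simp: is_arg_min_def not_less)
qed

section \<open>Coefficient identities and one-step decrease of the potential\<close>

text \<open>With \<open>s\<close> the square root, \<open>(1 - q)\<^sup>2 * a'\<close> and
  \<open>(1 + q + q * a) * d\<close> are affine in \<open>s\<close>. Clearing denominators makes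
  each identity polynomial modulo \<open>s\<^sup>2 = (1 + a) * (1 + q * a)\<close>.\<close>

lemma item_coefficients:
  fixes q a a' d :: real
  assumes q: "0 < q" "q < 1" and a: "0 \<le> a"
    and a': "a' = ((1 + q) * a + 2 * (1 + sqrt ((1 + a) * (1 + q * a)))) / (1 - q)\<^sup>2"
    and d: "d = ((1 - q)\<^sup>2 * a' - (1 + q) * a) / (2 * (1 + q + q * a))"
  shows "(1 + q * a') * (1 - q * d)\<^sup>2 = 1 + q * a"
    and "(1 + q * a') * d\<^sup>2 = a'"
    and "(1 - q) * a' - a = 2 * (1 + q * a') * d * (1 - q * d)"
    and "a / (1 - sqrt q)\<^sup>2 \<le> a'" "1 / (1 - sqrt q)\<^sup>2 \<le> a'" "a \<le> a'" "0 < a'"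
proof -
  define s where "s = sqrt ((1 + a) * (1 + q * a))"
  define D where "D = 1 + q + q * a"
  have D: "D > 0" unfolding D_def using q a by (simp add: add_pos_nonneg)
  have s2: "s\<^sup>2 = (1 + a) * (1 + q * a)" unfolding s_def using q a by simp
  have A': "(1 - q)\<^sup>2 * a' = (1 + q) * a + 2 * (1 + s)"
    unfolding a' s_def using q by simp
  have Dd: "D * d = 1 + s"
    unfolding d A' D_def[symmetric] using D by simp
  have "(1 - q)\<^sup>2 * D\<^sup>2 * ((1 + q * a') * (1 - q * d)\<^sup>2 - (1 + q * a))
    = ((1 - q)\<^sup>2 + q * ((1 - q)\<^sup>2 * a')) * (D - q * (D * d))\<^sup>2 - (1 - q)\<^sup>2 * D\<^sup>2 * (1 + q * a)"
    by algebra
  also have "\<dots> = 0" unfolding A' Dd unfolding D_def using s2 by algebra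
  finally show "(1 + q * a') * (1 - q * d)\<^sup>2 = 1 + q * a" using q D by simp
  have "(1 - q)\<^sup>2 * D\<^sup>2 * ((1 + q * a') * d\<^sup>2 - a')
    = ((1 - q)\<^sup>2 + q * ((1 - q)\<^sup>2 * a')) * (D * d)\<^sup>2 - D\<^sup>2 * ((1 - q)\<^sup>2 * a')"
    by algebra
  also have "\<dots> = 0" unfolding A' Dd unfolding D_def using s2 by algebra
  finally show "(1 + q * a') * d\<^sup>2 = a'" using q D by simp
  have "(1 - q)\<^sup>2 * D\<^sup>2 * ((1 - q) * a' - a - 2 * (1 + q * a') * d * (1 - q * d))
    = D\<^sup>2 * ((1 - q) * ((1 - q)\<^sup>2 * a') - (1 - q)\<^sup>2 * a)
      - 2 * ((1 - q)\<^sup>2 + q * ((1 - q)\<^sup>2 * a')) * (D * d) * (D - q * (D * d))"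
    by algebra
  also have "\<dots> = 0" unfolding A' Dd unfolding D_def using s2 by algebra
  finally show "(1 - q) * a' - a = 2 * (1 + q * a') * d * (1 - q * d)" using q D by simp

  define r where "r = sqrt q"
  have r: "0 < r" "r < 1" "q = r\<^sup>2" unfolding r_def using q by auto
  have fac: "(1 - q)\<^sup>2 = (1 - r)\<^sup>2 * (1 + r)\<^sup>2" unfolding r(3) by algebra
  \<comment> \<open>Hence \<open>(1 + q) * a + 2 * s\<close> is at least
    \<open>(1 + r)\<^sup>2 * a\<close>; this factor cancels in \<open>fac\<close> and leaves growth
    by \<open>1 / (1 - r)\<^sup>2\<close>.\<close>
  have "r * a \<le> s"
    unfolding s_def r(3) using a r
    by (intro real_le_rsqrt) (simp add: power2_eq_square algebra_simps)
  then have "(1 + r)\<^sup>2 * a \<le> (1 - q)\<^sup>2 * a'"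
    unfolding A' unfolding r(3) by (simp add: power2_eq_square algebra_simps)
  then have "(1 + r)\<^sup>2 * a \<le> (1 + r)\<^sup>2 * ((1 - r)\<^sup>2 * a')"
    unfolding fac by (simp add: mult_ac)
  then have "a \<le> (1 - r)\<^sup>2 * a'" using r by simp
  then show "a / (1 - sqrt q)\<^sup>2 \<le> a'" unfolding r_def[symmetric] using r by (simp add: field_simps)
  \<comment> \<open>This covers the start \<open>a = 0\<close>, where the ratio bound gives only
    \<open>0 \<le> a'\<close>.\<close>
  have "1 \<le> s" unfolding s_def using q a by (intro real_le_rsqrt) (simp add: algebra_simps)
  moreover have "0 \<le> (1 + q) * a" using q a by simp
  ultimately have "4 \<le> (1 - q)\<^sup>2 * a'" unfolding A' by simp
  moreover have "(1 + r)\<^sup>2 \<le> 2\<^sup>2" using r by (intro power_mono) auto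
  ultimately have "(1 + r)\<^sup>2 * 1 \<le> (1 + r)\<^sup>2 * ((1 - r)\<^sup>2 * a')"
    unfolding fac by (simp add: mult_ac)
  then have "1 \<le> (1 - r)\<^sup>2 * a'" using r by simp
  then show *: "1 / (1 - sqrt q)\<^sup>2 \<le> a'" unfolding r_def[symmetric] using r by (simp add: field_simps)
  have "0 < 1 / (1 - sqrt q)\<^sup>2" using r unfolding r_def by simp
  with * show pos: "0 < a'" by linarith
  have "(1 - r)\<^sup>2 * a' \<le> 1 * a'" using r pos by (intro mult_right_mono power_le_one) auto
  with \<open>a \<le> (1 - r)\<^sup>2 * a'\<close> show "a \<le> a'" by simp
qed

text \<open>The vector \<open>v = (x - P) / lam - \<mu> (P - s)\<close> is a subgradient at \<open>P\<close> of \<open>g\<close> minus \<open>\<mu> / 2\<close> times the squared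
  distance to \<open>s\<close>. In terms of \<open>v\<close> the step reads \<open>z' - s = (1 - q d) (z - s) - (q d / \<mu>) v\<close>, and
  \<open>a' (P - s) - a (p - s)\<close> is a combination of \<open>z - s\<close> and \<open>v\<close>; the three identities for \<open>a'\<close> and \<open>d\<close>
  say that all coefficients match exactly.\<close>

lemma item_potential_step:
  fixes p P x z s :: "'a::real_inner"
  assumes lam: "lam > 0" and mu: "\<mu> > 0" and q: "q = lam * \<mu> / (lam * \<mu> + 1)"
    and a: "0 \<le> a" "a \<le> a'" "0 < a'"
    and E1: "(1 + q * a') * (1 - q * d)\<^sup>2 = 1 + q * a"
    and E2: "(1 + q * a') * d\<^sup>2 = a'"
    and E3: "(1 - q) * a' - a = 2 * (1 + q * a') * d * (1 - q * d)"
    and x: "x = (a / ((1 - q) * a')) *\<^sub>R p + (1 - a / ((1 - q) * a')) *\<^sub>R z"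
    and z': "z' = (q * d) *\<^sub>R (x - (lam + 1 / \<mu>) *\<^sub>R (- (1 / lam) *\<^sub>R (P - x))) + (1 - q * d) *\<^sub>R z"
    and I1: "a * (G + 1 / lam * inner (x - P) (p - P) + \<mu> / 2 * (norm (p - P))\<^sup>2) \<le> a * g"
    and I2: "G + 1 / lam * inner (x - P) (s - P) + \<mu> / 2 * (norm (s - P))\<^sup>2 \<le> g0"
  shows "q / \<mu> * a' * (G - g0 - \<mu> / 2 * (norm (P - s))\<^sup>2) + (1 + q * a') * (norm (z' - s))\<^sup>2
    \<le> q / \<mu> * a * (g - g0 - \<mu> / 2 * (norm (p - s))\<^sup>2) + (1 + q * a) * (norm (z - s))\<^sup>2"
proof -
  define v where "v = (1 / lam) *\<^sub>R (x - P) - \<mu> *\<^sub>R (P - s)"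
  have pos: "lam * \<mu> + 1 > 0" using lam mu by (simp add: add_pos_pos)
  have q0: "q > 0" and q1: "1 - q = 1 / (lam * \<mu> + 1)"
    unfolding q using lam mu pos by (auto simp: field_simps)
  have xP: "x - P = lam *\<^sub>R (v + \<mu> *\<^sub>R (P - s))"
    unfolding v_def using lam by simp
  have Ps: "P - s = (1 - q) *\<^sub>R (x - s) - (q / \<mu>) *\<^sub>R v"
  proof -
    have "x - s = (lam * \<mu> + 1) *\<^sub>R (P - s) + lam *\<^sub>R v"
      using xP by (simp add: algebra_simps)
    moreover have "(1 - q) * (lam * \<mu> + 1) = 1" "(1 - q) * lam = q / \<mu>"
      unfolding q1 using pos mu by (simp_all add: q)
    ultimately show ?thesis
      by (simp add: scaleR_add_right)
  qed
  \<comment> \<open>The step length \<open>lam + 1 / \<mu>\<close> makes \<open>P\<close> cancel: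
    the long step ends exactly at \<open>s - (1 / \<mu>) *\<^sub>R v\<close>.\<close>
  have zs: "z' - s = (1 - q * d) *\<^sub>R (z - s) - (q * d / \<mu>) *\<^sub>R v"
  proof -
    have "- (1 / lam) *\<^sub>R (P - x) = (1 / lam) *\<^sub>R (x - P)"
      by (simp add: scaleR_diff_right)
    then have "x - (lam + 1 / \<mu>) *\<^sub>R (- (1 / lam) *\<^sub>R (P - x)) = x - ((lam + 1 / \<mu>) / lam) *\<^sub>R (x - P)"
      by simp
    also have "\<dots> = s - (1 / \<mu>) *\<^sub>R v"
    proof -
      have "(lam + 1 / \<mu>) / lam = 1 + 1 / (lam * \<mu>)" using lam mu by (simp add: field_simps)
      then have "x - ((lam + 1 / \<mu>) / lam) *\<^sub>R (x - P) = P - (1 / (lam * \<mu>)) *\<^sub>R (x - P)"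
        by (simp add: scaleR_left_distrib)
      also have "\<dots> = P - (1 / \<mu>) *\<^sub>R (v + \<mu> *\<^sub>R (P - s))"
        unfolding xP using lam by simp
      also have "\<dots> = s - (1 / \<mu>) *\<^sub>R v" using mu by (simp add: scaleR_add_right)
      finally show ?thesis .
    qed
    finally have st: "x - (lam + 1 / \<mu>) *\<^sub>R (- (1 / lam) *\<^sub>R (P - x)) = s - (1 / \<mu>) *\<^sub>R v" .
    show ?thesis unfolding z' st by (simp add: algebra_simps)
  qed
  \<comment> \<open>The weight of \<open>p\<close> in \<open>x\<close> is such that scaling by
    \<open>a' * (1 - q)\<close> gives exactly \<open>a\<close>, so \<open>p\<close> and
    \<open>P\<close> drop out of the weighted sum of inner products below.\<close>
  have comb: "a' *\<^sub>R (P - s) = a *\<^sub>R (p - s) + ((1 - q) * a' - a) *\<^sub>R (z - s) - (a' * q / \<mu>) *\<^sub>R v"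
  proof -
    have k: "a' * (1 - q) * (a / ((1 - q) * a')) = a" using a q1 pos by simp
    have "x - s = (a / ((1 - q) * a')) *\<^sub>R (p - s) + (1 - a / ((1 - q) * a')) *\<^sub>R (z - s)"
      unfolding x by (simp add: algebra_simps)
    then have "(a' * (1 - q)) *\<^sub>R (x - s)
        = (a' * (1 - q) * (a / ((1 - q) * a'))) *\<^sub>R (p - s)
          + (a' * (1 - q) - a' * (1 - q) * (a / ((1 - q) * a'))) *\<^sub>R (z - s)"
      by (simp add: scaleR_add_right right_diff_distrib)
    then show ?thesis unfolding k Ps by (simp add: scaleR_diff_right mult_ac)
  qed
  have xPi: "1 / lam * inner (x - P) y = inner v y + \<mu> * inner (P - s) y" for y
    unfolding xP using lam by (simp add: inner_left_distrib)
  \<comment> \<open>Recentring the quadratic from \<open>P\<close> to \<open>s\<close> turns the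
    strong convexity bounds into plain subgradient inequalities for \<open>F\<close> and
    \<open>f\<close>.\<close>
  have nrm: "\<mu> * inner (P - s) (y - P) + \<mu> / 2 * (norm (y - P))\<^sup>2
      = \<mu> / 2 * (norm (y - s))\<^sup>2 - \<mu> / 2 * (norm (P - s))\<^sup>2" for y
    unfolding power2_norm_eq_inner
    by (simp add: inner_diff_left inner_diff_right inner_commute field_simps)
  define F where "F = G - g0 - \<mu> / 2 * (norm (P - s))\<^sup>2"
  define f where "f = g - g0 - \<mu> / 2 * (norm (p - s))\<^sup>2"
  have J1: "a * (F + inner v (p - P)) \<le> a * f"
  proof -
    have "F + inner v (p - P) = G + 1 / lam * inner (x - P) (p - P) + \<mu> / 2 * (norm (p - P))\<^sup>2
      - (g0 + \<mu> / 2 * (norm (p - s))\<^sup>2)"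
      unfolding xPi F_def using nrm[of p] by simp
    with I1 show ?thesis unfolding f_def by (simp add: right_diff_distrib distrib_left)
  qed
  have J2: "(a' - a) * (F + inner v (s - P)) \<le> 0"
  proof -
    have "F + inner v (s - P) \<le> 0"
      using I2 nrm[of s] unfolding xPi F_def by simp
    then show ?thesis using a by (simp add: mult_nonneg_nonpos)
  qed
  have "a * inner v (p - P) + (a' - a) * inner v (s - P)
      = inner v (a *\<^sub>R (p - s)) - inner v (a' *\<^sub>R (P - s))"
    by (simp add: inner_diff_right algebra_simps)
  also have "\<dots> = a' * (q / \<mu>) * inner v v - ((1 - q) * a' - a) * inner v (z - s)"
    unfolding comb by (simp add: inner_add_right inner_diff_right)
  finally have "a' * F + a' * (q / \<mu>) * inner v v - ((1 - q) * a' - a) * inner v (z - s) \<le> a * f"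
    using J1 J2 by (simp add: algebra_simps)
  then have le: "q / \<mu> * (a' * F + a' * (q / \<mu>) * inner v v - ((1 - q) * a' - a) * inner v (z - s))
      \<le> q / \<mu> * (a * f)"
    using q0 mu by (intro mult_left_mono) auto
  have eq: "(1 + q * a') * (norm (z' - s))\<^sup>2
      = ((1 + q * a') * (1 - q * d)\<^sup>2) * (norm (z - s))\<^sup>2
        - q / \<mu> * (2 * (1 + q * a') * d * (1 - q * d)) * inner v (z - s)
        + (q / \<mu>)\<^sup>2 * ((1 + q * a') * d\<^sup>2) * inner v v"
  proof -
    have "(norm (b *\<^sub>R X - e *\<^sub>R v))\<^sup>2 = b\<^sup>2 * (norm X)\<^sup>2 - 2 * b * e * inner v X + e\<^sup>2 * inner v v"
      for b e and X :: 'a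
      unfolding power2_norm_eq_inner
      by (simp add: inner_commute power2_eq_square algebra_simps)
    from this[of "1 - q * d" "z - s" "q / \<mu> * d"]
    have "(norm (z' - s))\<^sup>2 = (1 - q * d)\<^sup>2 * (norm (z - s))\<^sup>2
        - 2 * (1 - q * d) * (q / \<mu> * d) * inner v (z - s) + (q / \<mu> * d)\<^sup>2 * inner v v"
      unfolding zs by simp
    then show ?thesis by algebra
  qed
  \<comment> \<open>Here \<open>Q = q / \<mu>\<close>, \<open>c = (1 - q) * a' - a\<close>,
    \<open>I = inner v (z - s)\<close> and \<open>V = inner v v\<close>; the \<open>I\<close> and
    \<open>V\<close> terms of the scaled inequality are exactly \<open>N - n\<close>.\<close>
  have fin: "Q * a' * F + N \<le> Q * a * f + n"
    if "Q * (a' * F + a' * Q * V - c * I) \<le> Q * (a * f)" "N = n - Q * c * I + Q\<^sup>2 * a' * V"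
    for Q c I V N n :: real
    using that by (simp add: power2_eq_square algebra_simps)
  show ?thesis
    using fin[OF le] eq unfolding E1 E2 E3[symmetric] F_def f_def by simp
qed

section \<open>Descent along the iterates and the resulting rate\<close>

theorem theorem4:
  fixes g :: "real ^ 'n \<Rightarrow> ereal"
    and lam \<mu> q :: real
    and A \<gamma> \<delta> :: "nat \<Rightarrow> real"
    and x z :: "nat \<Rightarrow> real ^ 'n"
    and x_star :: "real ^ 'n"
  assumes "lam > 0" and "\<mu> > 0"
    and "closed_fun g" and "proper_fun g" and "strongly_convex_fun \<mu> g"
    and "is_arg_min g (\<lambda>_. True) x_star"
    and "q = lam * \<mu> / (lam * \<mu> + 1)"
    and "A 0 = 0"
    and "\<And>k. A (Suc k) = ((1 + q) * A k + 2 * (1 + sqrt ((1 + A k) * (1 + q * A k)))) / (1 - q)\<^sup>2"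
    and "\<And>k. \<gamma> k = A k / ((1 - q) * A (Suc k))"
    and "\<And>k. \<delta> k = ((1 - q)\<^sup>2 * A (Suc k) - (1 + q) * A k) / (2 * (1 + q + q * A k))"
    and "z 0 = x 0"
    and "\<And>k. x k = \<gamma> k *\<^sub>R (case k of 0 \<Rightarrow> x 0 | Suc j \<Rightarrow> prox lam g (x j)) + (1 - \<gamma> k) *\<^sub>R z k"
    and "\<And>k. z (Suc k) = (q * \<delta> k) *\<^sub>R prox_step lam \<mu> g (x k) + (1 - q * \<delta> k) *\<^sub>R z k"
  shows "\<forall>k\<ge>1. (norm (z k - x_star))\<^sup>2
           \<le> (1 - sqrt q) ^ (2 * k) / ((1 - sqrt q) ^ (2 * k) + q) * (norm (z 0 - x_star))\<^sup>2"
proof -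
  note lam = assms(1) and mu = assms(2) and xeq = assms(13) and zeq = assms(14)
  have pos: "lam * \<mu> + 1 > 0" using lam mu by (simp add: add_pos_pos)
  have q: "0 < q" "q < 1" unfolding assms(7) using lam mu pos by auto
  have min: "g x_star \<le> g y" for y using assms(6) by (simp add: is_arg_min_def not_less)
  obtain g0 where g0: "g x_star = ereal g0"
  proof -
    obtain y where "g y \<noteq> \<infinity>" "g x_star \<noteq> -\<infinity>" using assms(4) by (auto simp: proper_fun_def)
    then show thesis using min[of y] that by (cases "g x_star") auto
  qed
  define P where "P k = prox lam g (x k)" for k
  \<comment> \<open>\<open>x_star\<close> supplies both the lower bound \<open>g0\<close> and a
    point of finite value.\<close>
  have Pmin: "g (P k) + ereal (1 / lam / 2 * (norm (P k - x k))\<^sup>2)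
      \<le> g y + ereal (1 / lam / 2 * (norm (y - x k))\<^sup>2)" for k y
    using prox_minimizes[OF assms(3) lam _ g0, of g0 "x k" y] min unfolding g0 P_def
    by (simp add: mult.commute)
  define G where "G k = real_of_ereal (g (P k))" for k
  have G: "g (P k) = ereal (G k)" for k
    using Pmin[of k x_star] min[of "P k"] unfolding g0 G_def by (cases "g (P k)") auto
  have growth: "g0 + \<mu> / 2 * (norm (P k - x_star))\<^sup>2 \<le> G k" for k
    using strongly_convex_prox_ineq[OF assms(5) G g0, of 0] min by simp
  have Apos: "0 \<le> A k" for k
  proof (induction k)
    case 0
    show ?case using assms(8) by simp
  next
    case (Suc k)
    from item_coefficients(7)[OF q this assms(9) assms(11)] show ?case by simp
  qed
  note coeff = item_coefficients[OF q Apos assms(9) assms(11)]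
  \<comment> \<open>Indices shift by one, with \<open>p 0 = x 0\<close>. Since
    \<open>g (x 0)\<close> may be infinite, \<open>\<phi> 0\<close> is a dummy value; it occurs only
    multiplied by \<open>A 0 = 0\<close>.\<close>
  define p where "p k = (case k of 0 \<Rightarrow> x 0 | Suc j \<Rightarrow> P j)" for k
  define \<phi> where "\<phi> k = (case k of 0 \<Rightarrow> 0 | Suc j \<Rightarrow> G j)" for k
  define \<Phi> where "\<Phi> k = q / \<mu> * A k * (\<phi> k - g0 - \<mu> / 2 * (norm (p k - x_star))\<^sup>2)
    + (1 + q * A k) * (norm (z k - x_star))\<^sup>2" for k
  have step: "\<Phi> (Suc k) \<le> \<Phi> k" for k
  proof -
    have "x k = (A k / ((1 - q) * A (Suc k))) *\<^sub>R p k + (1 - A k / ((1 - q) * A (Suc k))) *\<^sub>R z k"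
      using xeq[of k] unfolding assms(10) p_def P_def .
    moreover have "z (Suc k) = (q * \<delta> k) *\<^sub>R (x k - (lam + 1 / \<mu>) *\<^sub>R (- (1 / lam) *\<^sub>R (P k - x k)))
        + (1 - q * \<delta> k) *\<^sub>R z k"
      using zeq[of k] unfolding prox_step_def prox_grad_def P_def .
    moreover have "A k * (G k + 1 / lam * inner (x k - P k) (p k - P k) + \<mu> / 2 * (norm (p k - P k))\<^sup>2)
        \<le> A k * \<phi> k"
    proof (cases k)
      case 0
      then show ?thesis using assms(8) by simp
    next
      case (Suc j)
      then have "g (p k) = ereal (\<phi> k)" using G by (simp add: p_def \<phi>_def)
      from strongly_convex_prox_ineq[OF assms(5) this G Pmin] show ?thesis
        using Apos by (intro mult_left_mono)
    qed
    moreover have "G k + 1 / lam * inner (x k - P k) (x_star - P k) + \<mu> / 2 * (norm (x_star - P k))\<^sup>2 \<le> g0"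
      by (rule strongly_convex_prox_ineq[OF assms(5) g0 G Pmin])
    ultimately have "q / \<mu> * A (Suc k) * (G k - g0 - \<mu> / 2 * (norm (P k - x_star))\<^sup>2)
        + (1 + q * A (Suc k)) * (norm (z (Suc k) - x_star))\<^sup>2 \<le> \<Phi> k"
      unfolding \<Phi>_def
      by (rule item_potential_step[OF lam mu assms(7) Apos coeff(6,7) coeff(1-3)])
    then show ?thesis unfolding \<Phi>_def[of "Suc k"] by (simp add: p_def \<phi>_def)
  qed
  have \<Phi>0: "\<Phi> k \<le> (norm (z 0 - x_star))\<^sup>2" for k
  proof (induction k)
    case 0
    show ?case by (simp add: \<Phi>_def assms(8))
  next
    case (Suc k)
    with step show ?case by (rule order_trans)
  qed
  define \<rho> where "\<rho> = (1 - sqrt q)\<^sup>2"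
  have \<rho>: "\<rho> > 0" unfolding \<rho>_def using q by simp
  \<comment> \<open>The induction starts at index 1, because \<open>A 0 = 0\<close> is below
    \<open>1 / \<rho> ^ 0\<close>.\<close>
  have Alow: "1 / \<rho> ^ Suc k \<le> A (Suc k)" for k
  proof (induction k)
    case 0
    show ?case using coeff(5)[of 0] unfolding \<rho>_def by simp
  next
    case (Suc k)
    have "1 / \<rho> ^ Suc (Suc k) = (1 / \<rho> ^ Suc k) / \<rho>" by simp
    also have "\<dots> \<le> A (Suc k) / \<rho>" using Suc \<rho> by (intro divide_right_mono) auto
    also have "\<dots> \<le> A (Suc (Suc k))" using coeff(4) unfolding \<rho>_def .
    finally show ?case .
  qed
  show ?thesis
  proof (intro allI impI)
    \<comment> \<open>At \<open>k = 0\<close> the factor would be \<open>1 / (1 + q) < 1\<close>,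
      which fails unless \<open>z 0 = x_star\<close>.\<close>
    fix k :: nat
    assume "1 \<le> k"
    then obtain j where k: "k = Suc j" by (cases k) auto
    let ?N = "(norm (z k - x_star))\<^sup>2" and ?M = "(norm (z 0 - x_star))\<^sup>2"
    have "0 \<le> q / \<mu> * A k * (\<phi> k - g0 - \<mu> / 2 * (norm (p k - x_star))\<^sup>2)"
      using growth[of j] q mu Apos[of k] unfolding k by (simp add: p_def \<phi>_def)
    then have "(1 + q * A k) * ?N \<le> ?M" using \<Phi>0[of k] unfolding \<Phi>_def by linarith
    moreover have "(1 + q * (1 / \<rho> ^ k)) * ?N \<le> (1 + q * A k) * ?N"
      using Alow[of j] q unfolding k[symmetric]
      by (intro mult_right_mono add_left_mono mult_left_mono) auto
    ultimately have "(1 + q * (1 / \<rho> ^ k)) * ?N \<le> ?M" by (rule order_trans[rotated])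
    then have "\<rho> ^ k * ((1 + q * (1 / \<rho> ^ k)) * ?N) \<le> \<rho> ^ k * ?M"
      using \<rho> by (intro mult_left_mono) auto
    also have "\<rho> ^ k * ((1 + q * (1 / \<rho> ^ k)) * ?N) = (\<rho> ^ k + q) * ?N"
      using \<rho> by (simp add: distrib_left distrib_right)
    finally have "?N \<le> \<rho> ^ k * ?M / (\<rho> ^ k + q)"
      using \<rho> q by (subst pos_le_divide_eq) (simp_all add: add_pos_pos mult.commute)
    moreover have "\<rho> ^ k = (1 - sqrt q) ^ (2 * k)"
      unfolding \<rho>_def by (rule power_mult[symmetric])
    ultimately show "?N \<le> (1 - sqrt q) ^ (2 * k) / ((1 - sqrt q) ^ (2 * k) + q) * ?M"
      by simp
  qed
qed

end
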